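(* For every fixed $\varepsilon>0$ there exists $N_0(\varepsilon)$ such that for every positive integer $N>N_0(\varepsilon)$ the set $$\Bigl\{n^2 : n\in\mathbb{N},\ N \le n\le N+\sqrt{(8+\varepsilon)N}\Bigr\}$$ is not a Sidon set.
   Context: $\mathbb{N}$ denotes the positive integers. A set $\mathcal{A}$ of integers is called a Sidon set if the equation $a_1+a_2=a_3+a_4$ with $a_1,a_2,a_3,a_4\in\mathcal{A}$ has only trivial solutions, i.e. every solution satisfies $\{a_1,a_2\}=\{a_3,a_4\}$. *)

theory Defs
  imports Complex_Main
begin

definition sidon_set :: "int set \<Rightarrow> bool" where
  "sidon_set A \<longleftrightarrow>
     (\<forall>a1\<in>A. \<forall>a2\<in>A. \<forall>a3\<in>A. \<forall>a4\<in>A. a1 + a2 = a3 + a4 \<longrightarrow> {a1, a2} = {a3, a4})"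

end

theory Submission
  imports Defs "HOL-Real_Asymp.Real_Asymp"
begin

text \<open>
  For positive integers \<open>q\<close> and \<open>u\<close> the product \<open>P = q u\<close> satisfies
  \<open>(P + 2q + u + 1)\<^sup>2 + (P - 1)\<^sup>2 = (P + u + 1)\<^sup>2 + (P + 2q + 1)\<^sup>2\<close>,
  a coincidence among four integers that all lie between \<open>P - 1\<close> and \<open>P + 2q + u + 1\<close>.
  So the squares of an interval starting at \<open>N\<close> fail to be Sidon as soon as some product
  \<open>q u\<close> is at least \<open>N + 1\<close>, exceeds it only by \<open>o(sqrt N)\<close>, and has \<open>2q + u\<close> close to its
  minimum. By the inequality of arithmetic and geometric means this minimum is
  \<open>2 sqrt (2 q u)\<close>, about \<open>sqrt (8 N)\<close>, which is where the constant 8 comes from.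

  Both demands can be met because the product is almost stationary near the optimum \<open>u = 2q\<close>:
  with \<open>q = m + e\<close> and \<open>u = 2(m - e)\<close> the sum \<open>2q + u = 4m\<close> does not depend on \<open>e\<close>,
  while \<open>q u = 2(m\<^sup>2 - e\<^sup>2)\<close> decreases slowly in \<open>e\<close>. Taking \<open>m\<close> least with
  \<open>2 m\<^sup>2 \<ge> M\<close> and then \<open>e\<close> greatest with \<open>2(m\<^sup>2 - e\<^sup>2) \<ge> M\<close>, where \<open>M = N + 1\<close>, overshoots
  \<open>M\<close> by \<open>O(e) = O(sqrt m)\<close> only, that is, by the order of the fourth root of \<open>N\<close>
  (lemma \<open>almost_balanced_product_above\<close>).
\<close>

text \<open>
  The identity is the case \<open>p = 2\<close>, \<open>r = q + 1\<close>, \<open>s = 2(u + 1)\<close> of the general solution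
  \<open>((rs + pq)/2)\<^sup>2 - ((rs - pq)/2)\<^sup>2 = pqrs = ((qs + pr)/2)\<^sup>2 - ((qs - pr)/2)\<^sup>2\<close>.
\<close>

lemma sum_of_squares_coincidence:
  fixes q u :: "'a :: comm_ring_1"
  shows "(q * u + 2 * q + u + 1)\<^sup>2 + (q * u - 1)\<^sup>2 = (q * u + u + 1)\<^sup>2 + (q * u + 2 * q + 1)\<^sup>2"
  by (simp add: power2_eq_square algebra_simps)

lemma not_sidon_if_contains_coincidence:
  fixes q u :: nat
  assumes "q > 0" "u > 0"
    and mem: "\<And>n. q * u - 1 \<le> n \<Longrightarrow> n \<le> q * u + 2 * q + u + 1 \<Longrightarrow> (int n)\<^sup>2 \<in> A"
  shows "\<not> sidon_set A"
proof
  assume sidon: "sidon_set A"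
  define a b c d where "a = q * u + 2 * q + u + 1" and "b = q * u - 1"
    and "c = q * u + u + 1" and "d = q * u + 2 * q + 1"
  have "(int a)\<^sup>2 \<in> A" "(int b)\<^sup>2 \<in> A" "(int c)\<^sup>2 \<in> A" "(int d)\<^sup>2 \<in> A"
    by (intro mem; simp add: a_def b_def c_def d_def)+
  moreover have "q * u \<ge> 1"
    using assms by (simp add: Suc_le_eq)
  then have "(int a)\<^sup>2 + (int b)\<^sup>2 = (int c)\<^sup>2 + (int d)\<^sup>2"
    using sum_of_squares_coincidence[of "int q" "int u"]
    by (simp add: a_def b_def c_def d_def of_nat_diff algebra_simps)
  ultimately have "{(int a)\<^sup>2, (int b)\<^sup>2} = {(int c)\<^sup>2, (int d)\<^sup>2}"
    using sidon unfolding sidon_set_def by blast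
  \<comment> \<open>The pairs differ because \<open>a\<close> is strictly the largest of the four.\<close>
  then have "(int a)\<^sup>2 = (int c)\<^sup>2 \<or> (int a)\<^sup>2 = (int d)\<^sup>2"
    by blast
  then have "a = c \<or> a = d"
    by (simp only: power2_eq_iff_nonneg of_nat_0_le_iff of_nat_eq_iff)
  then show False
    using assms by (simp add: a_def c_def d_def)
qed

text \<open>
  Here \<open>m\<close> is least with \<open>2 m\<^sup>2 \<ge> M\<close>, and \<open>e\<close> is then greatest. The bound \<open>e\<^sup>2 < 2m\<close> comes from the minimality of
  \<open>m\<close>, which gives \<open>2 m\<^sup>2 - M < 4m\<close>.
\<close>

lemma difference_of_squares_above:
  fixes M :: nat
  assumes "M > 0"
  obtains m e :: nat where
    "M + 2 * e\<^sup>2 \<le> 2 * m\<^sup>2" "2 * m\<^sup>2 \<le> M + 2 * e\<^sup>2 + 4 * e + 1" "2 * (real m - 1)\<^sup>2 < M" "e\<^sup>2 < 2 * m"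
proof -
  define m where "m = (LEAST m. M \<le> 2 * m\<^sup>2)"
  have "M \<le> 2 * M\<^sup>2"
    by (simp add: power2_eq_square trans_le_add1)
  then have m: "M \<le> 2 * m\<^sup>2"
    unfolding m_def by (rule LeastI)
  with assms obtain k where k: "m = Suc k"
    by (cases m) auto
  have "2 * k\<^sup>2 < M"
    using not_less_Least[of k "\<lambda>m. M \<le> 2 * m\<^sup>2"] k by (simp add: m_def)
  define e where "e = (GREATEST e. M + 2 * e\<^sup>2 \<le> 2 * m\<^sup>2)"
  have bounded: "e \<le> m" if "M + 2 * e\<^sup>2 \<le> 2 * m\<^sup>2" for e
  proof -
    have "e\<^sup>2 \<le> m\<^sup>2"
      using that by linarith
    then show ?thesis
      by (rule power2_le_imp_le) simp
  qed
  have e: "M + 2 * e\<^sup>2 \<le> 2 * m\<^sup>2"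
    unfolding e_def by (rule GreatestI_nat[of _ 0 m]) (use m bounded in auto)
  have "\<not> M + 2 * (Suc e)\<^sup>2 \<le> 2 * m\<^sup>2"
  proof
    assume "M + 2 * (Suc e)\<^sup>2 \<le> 2 * m\<^sup>2"
    then have "Suc e \<le> e"
      unfolding e_def by (rule Greatest_le_nat[of _ _ m]) (use bounded in auto)
    then show False by simp
  qed
  then have "2 * m\<^sup>2 \<le> M + 2 * e\<^sup>2 + 4 * e + 1"
    by (simp add: power2_eq_square)
  moreover have "2 * (real m - 1)\<^sup>2 < M"
  proof -
    have "real (2 * k\<^sup>2) < real M"
      using \<open>2 * k\<^sup>2 < M\<close> by (simp only: of_nat_less_iff)
    then show ?thesis
      using k by simp
  qed
  moreover have "e\<^sup>2 < 2 * m"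
    using e \<open>2 * k\<^sup>2 < M\<close> k by (simp add: power2_eq_square)
  ultimately show thesis
    using e that by blast
qed

text \<open>
  In the bound the term \<open>sqrt (8 M)\<close> comes from \<open>2q + u = 4m\<close>, and the term of fourth-root order
  bounds the overshoot \<open>4e\<close> of the product.
\<close>

lemma almost_balanced_product_above:
  fixes M :: nat
  assumes "M > 0"
  obtains q u :: nat where "q > 0" "u > 0" "M \<le> q * u"
    "real (q * u + 2 * q + u) \<le> M + sqrt (8 * M) + 4 * sqrt (2 * (sqrt (M / 2) + 1)) + 5"
proof -
  obtain m e :: nat where le: "M + 2 * e\<^sup>2 \<le> 2 * m\<^sup>2"
    and ge: "2 * m\<^sup>2 \<le> M + 2 * e\<^sup>2 + 4 * e + 1"
    and m: "2 * (real m - 1)\<^sup>2 < M" and e: "e\<^sup>2 < 2 * m"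
    using difference_of_squares_above[OF assms] .
  have "e\<^sup>2 < m\<^sup>2"
    using le assms by linarith
  then have "e < m"
    by (rule power2_less_imp_less) simp
  define q u where "q = m + e" and "u = 2 * (m - e)"
  have qu: "q * u + 2 * e\<^sup>2 = 2 * m\<^sup>2"
  proof -
    obtain k where "m = e + k"
      using \<open>e < m\<close> less_imp_add_positive by blast
    then show ?thesis
      by (simp add: q_def u_def power2_eq_square algebra_simps)
  qed
  have "(real m - 1)\<^sup>2 \<le> M / 2"
    using m by simp
  then have m_le: "real m \<le> sqrt (M / 2) + 1"
    using real_le_rsqrt by fastforce
  have "sqrt (8 * M) = sqrt (4\<^sup>2 * (M / 2))"
    by (rule arg_cong[where f = sqrt]) simp
  also have "\<dots> = 4 * sqrt (M / 2)"
    by (simp only: real_sqrt_mult) simp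
  finally have four_m: "4 * real m \<le> sqrt (8 * M) + 4"
    using m_le by linarith
  have "(real e)\<^sup>2 \<le> real (2 * m)"
    using e unfolding of_nat_power[symmetric] of_nat_le_iff by simp
  then have "(real e)\<^sup>2 \<le> 2 * (sqrt (M / 2) + 1)"
    using m_le by simp
  then have "real e \<le> sqrt (2 * (sqrt (M / 2) + 1))"
    by (rule real_le_rsqrt)
  moreover have "q * u + 2 * q + u \<le> M + 4 * e + 1 + 4 * m"
    using qu ge \<open>e < m\<close> by (simp add: q_def u_def)
  then have "real (q * u + 2 * q + u) \<le> real (M + 4 * e + 1 + 4 * m)"
    by (simp only: of_nat_le_iff)
  ultimately have
    "real (q * u + 2 * q + u) \<le> M + sqrt (8 * M) + 4 * sqrt (2 * (sqrt (M / 2) + 1)) + 5"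
    using four_m by simp
  moreover have "q > 0" "u > 0" "M \<le> q * u"
    using qu le \<open>e < m\<close> by (auto simp: q_def u_def)
  ultimately show thesis
    using that by blast
qed

theorem theorem2:
  fixes \<epsilon> :: real
  assumes "\<epsilon> > 0"
  shows "\<exists>N0::nat. \<forall>N::nat. 0 < N \<and> N > N0 \<longrightarrow>
           \<not> sidon_set {(int n)^2 | n::nat.
               0 < n \<and> N \<le> n \<and> real n \<le> real N + sqrt ((8 + \<epsilon>) * real N)}"
proof -
  have "(\<lambda>N. (sqrt (8 * (real N + 1)) + 4 * sqrt (2 * (sqrt ((real N + 1) / 2) + 1)) + 7)
      / sqrt (real N)) \<longlonglongrightarrow> 8 powr (1 / 2)"
    by real_asymp
  moreover have "(8::real) powr (1 / 2) < sqrt (8 + \<epsilon>)"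
    using assms by (simp add: powr_half_sqrt)
  ultimately have "\<forall>\<^sub>F N in sequentially.
      (sqrt (8 * (real N + 1)) + 4 * sqrt (2 * (sqrt ((real N + 1) / 2) + 1)) + 7) / sqrt (real N)
        < sqrt (8 + \<epsilon>)"
    by (rule order_tendstoD)
  then have "\<forall>\<^sub>F N::nat in sequentially.
      sqrt (8 * (real N + 1)) + 4 * sqrt (2 * (sqrt ((real N + 1) / 2) + 1)) + 7
        \<le> sqrt ((8 + \<epsilon>) * real N)"
    using eventually_gt_at_top[of 0]
    by eventually_elim (simp only: real_sqrt_mult, simp add: divide_less_eq)
  then obtain N0 :: nat where N0: "\<And>N. N \<ge> N0 \<Longrightarrow>
      sqrt (8 * (real N + 1)) + 4 * sqrt (2 * (sqrt ((real N + 1) / 2) + 1)) + 7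
        \<le> sqrt ((8 + \<epsilon>) * real N)"
    unfolding eventually_sequentially by blast
  have "\<not> sidon_set {(int n)^2 | n::nat.
      0 < n \<and> N \<le> n \<and> real n \<le> real N + sqrt ((8 + \<epsilon>) * real N)}"
    if "0 < N" "N > N0" for N :: nat
  proof -
    obtain q u :: nat where "q > 0" "u > 0" and lower: "N + 1 \<le> q * u"
      and upper: "real (q * u + 2 * q + u) \<le> real (N + 1) + sqrt (8 * real (N + 1))
        + 4 * sqrt (2 * (sqrt (real (N + 1) / 2) + 1)) + 5"
      using almost_balanced_product_above[of "N + 1"] by auto
    have fits: "real (q * u + 2 * q + u + 1) \<le> real N + sqrt ((8 + \<epsilon>) * real N)"
      using upper N0[of N] that by (simp add: add.commute)
    show ?thesis
    proof (rule not_sidon_if_contains_coincidence[OF \<open>q > 0\<close> \<open>u > 0\<close>])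
      fix n
      assume n: "q * u - 1 \<le> n" "n \<le> q * u + 2 * q + u + 1"
      have "N \<le> n"
        using n lower by linarith
      moreover have "real n \<le> real N + sqrt ((8 + \<epsilon>) * real N)"
        using n(2) fits by (meson of_nat_le_iff order_trans)
      ultimately show "(int n)\<^sup>2 \<in> {(int n)^2 | n::nat.
          0 < n \<and> N \<le> n \<and> real n \<le> real N + sqrt ((8 + \<epsilon>) * real N)}"
        using \<open>0 < N\<close> by auto
    qed
  qed
  then show ?thesis
    by blast
qed

end
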